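(* Let $p$ and $q$ be distinct positive integers. Let $A$ be a Banach algebra with a bounded approximate identity. Then $C_{p,q}^b(A)$ is a closed subspace of $C_{ts}(A)$.
   Context: Banach algebras are complex and associative. A map $T:A\to A$ is a $(p,q)$-centralizer if $(p+q)T(ab)=pT(a)b+q\,aT(b)$ for all $a,b\in A$; $C_{p,q}^b(A)$ is the space of all bounded (linear) $(p,q)$-centralizers of $A$. $T$ is a two-sided centralizer if $T(ab)=T(a)b$ and $T(ab)=aT(b)$ for all $a,b\in A$; $C_{ts}(A)$ is the set of all two-sided centralizers of $A$ (for $A$ with a bounded approximate identity these are automatically bounded and linear), with the operator norm. The bounded approximate identity is two-sided. *)

theory Defs
  imports "HOL-Analysis.Analysis" "HOL-Library.Function_Algebras"
begin

(* Complex Banach algebras, not assumed unital. The real structure of real_normed_algebra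
   is required to be the restriction of the complex one. *)
class complex_banach_algebra = real_normed_algebra + banach +
  fixes scaleC :: "complex \<Rightarrow> 'a \<Rightarrow> 'a" (infixr "*\<^sub>C" 75)
  assumes scaleC_of_real: "of_real r *\<^sub>C x = r *\<^sub>R x"
    and scaleC_add_right: "c *\<^sub>C (x + y) = c *\<^sub>C x + c *\<^sub>C y"
    and scaleC_add_left: "(c + d) *\<^sub>C x = c *\<^sub>C x + d *\<^sub>C x"
    and scaleC_scaleC: "c *\<^sub>C d *\<^sub>C x = (c * d) *\<^sub>C x"
    and mult_scaleC_left: "(c *\<^sub>C x) * y = c *\<^sub>C (x * y)"
    and mult_scaleC_right: "x * (c *\<^sub>C y) = c *\<^sub>C (x * y)"
    and norm_scaleC: "norm (c *\<^sub>C x) = cmod c * norm x"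

lemma scaleC_one: "1 *\<^sub>C x = (x :: 'a::complex_banach_algebra)"
  using scaleC_of_real[of 1 x] by simp

definition bounded_clinear :: "('a::complex_banach_algebra \<Rightarrow> 'a) \<Rightarrow> bool" where
  "bounded_clinear T \<longleftrightarrow> bounded_linear T \<and> (\<forall>c x. T (c *\<^sub>C x) = c *\<^sub>C T x)"

definition directed_set :: "'i set \<Rightarrow> ('i \<Rightarrow> 'i \<Rightarrow> bool) \<Rightarrow> bool" where
  "directed_set I le \<longleftrightarrow> I \<noteq> {} \<and> reflp_on I le \<and> transp_on I le \<and>
     (\<forall>i\<in>I. \<forall>j\<in>I. \<exists>k\<in>I. le i k \<and> le j k)"

(* The filter generated by the tails of the directed set; convergence along it is
   convergence of nets, see tendsto_net_filter_iff below. *)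
definition net_filter :: "'i set \<Rightarrow> ('i \<Rightarrow> 'i \<Rightarrow> bool) \<Rightarrow> 'i filter" where
  "net_filter I le = (INF i\<in>I. principal {j\<in>I. le i j})"

definition bounded_approximate_identity ::
    "'i set \<Rightarrow> ('i \<Rightarrow> 'i \<Rightarrow> bool) \<Rightarrow> ('i \<Rightarrow> 'a::complex_banach_algebra) \<Rightarrow> bool" where
  "bounded_approximate_identity I le e \<longleftrightarrow> directed_set I le \<and> bounded (e ` I) \<and>
     (\<forall>a. ((\<lambda>i. e i * a) \<longlongrightarrow> a) (net_filter I le) \<and> ((\<lambda>i. a * e i) \<longlongrightarrow> a) (net_filter I le))"

definition two_sided_centralizers :: "('a::complex_banach_algebra \<Rightarrow> 'a) set" where
  "two_sided_centralizers = {T. \<forall>a b. T (a * b) = T a * b \<and> T (a * b) = a * T b}"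

definition bounded_pq_centralizers ::
    "nat \<Rightarrow> nat \<Rightarrow> ('a::complex_banach_algebra \<Rightarrow> 'a) set" where
  "bounded_pq_centralizers p q = {T. bounded_clinear T \<and>
     (\<forall>a b. real (p + q) *\<^sub>R T (a * b) = real p *\<^sub>R (T a * b) + real q *\<^sub>R (a * T b))}"

definition fun_scaleC ::
    "complex \<Rightarrow> ('b \<Rightarrow> 'a::complex_banach_algebra) \<Rightarrow> 'b \<Rightarrow> 'a" where
  "fun_scaleC c T = (\<lambda>x. c *\<^sub>C T x)"

(* Blinfun is only meaningful on bounded linear maps. In the presence of a bounded
   approximate identity every two-sided centralizer is one, as shown by
   two_sided_centralizer_bounded_clinear below. *)
definition operator_norm_topology ::
    "('a::real_normed_vector \<Rightarrow> 'a) set \<Rightarrow> ('a \<Rightarrow> 'a) topology" where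
  "operator_norm_topology M = pullback_topology M Blinfun euclidean"

lemma eventually_net_filter:
  assumes "directed_set I le"
  shows "eventually P (net_filter I le) \<longleftrightarrow> (\<exists>i\<in>I. \<forall>j\<in>I. le i j \<longrightarrow> P j)"
proof -
  have "\<exists>k\<in>I. principal {l\<in>I. le k l} \<le> inf (principal {l\<in>I. le i l}) (principal {l\<in>I. le j l})"
    if ij: "i \<in> I" "j \<in> I" for i j
  proof -
    obtain k where k: "k \<in> I" "le i k" "le j k"
      using assms ij unfolding directed_set_def by blast
    have "{l\<in>I. le k l} \<subseteq> {l\<in>I. le i l} \<inter> {l\<in>I. le j l}"
      using assms ij k unfolding directed_set_def transp_on_def by blast
    with k(1) show ?thesis by auto
  qed
  moreover have "I \<noteq> {}" using assms by (simp add: directed_set_def)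
  ultimately show ?thesis
    unfolding net_filter_def
    by (subst eventually_INF_base) (auto simp: eventually_principal)
qed

lemma tendsto_net_filter_iff:
  fixes f :: "'i \<Rightarrow> 'a::real_normed_vector"
  assumes "directed_set I le"
  shows "(f \<longlongrightarrow> l) (net_filter I le) \<longleftrightarrow>
    (\<forall>\<epsilon>>0. \<exists>i\<in>I. \<forall>j\<in>I. le i j \<longrightarrow> norm (f j - l) < \<epsilon>)"
  by (simp add: tendsto_iff eventually_net_filter[OF assms] dist_norm)

lemma net_filter_neq_bot:
  assumes "directed_set I le"
  shows "net_filter I le \<noteq> bot"
  using assms unfolding trivial_limit_def eventually_net_filter[OF assms]
  by (auto simp: directed_set_def reflp_on_def)

lemma vector_space_fun_scaleC: "vector_space fun_scaleC"
  by unfold_locales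
    (auto simp: fun_scaleC_def fun_eq_iff scaleC_add_right scaleC_add_left scaleC_scaleC scaleC_one)

lemma subspace_two_sided_centralizers: "module.subspace fun_scaleC two_sided_centralizers"
proof -
  interpret vector_space fun_scaleC by (rule vector_space_fun_scaleC)
  show ?thesis
    by (rule subspaceI)
      (simp_all add: two_sided_centralizers_def fun_scaleC_def distrib_left distrib_right
        mult_scaleC_left mult_scaleC_right, metis+)
qed

lemma two_sided_centralizer_bounded_clinear:
  fixes e :: "'i \<Rightarrow> 'a::complex_banach_algebra" and T :: "'a \<Rightarrow> 'a"
  assumes bai: "bounded_approximate_identity I le e" and T: "T \<in> two_sided_centralizers"
  shows "bounded_clinear T"
proof -
  let ?F = "net_filter I le"
  have dir: "directed_set I le" and bdd: "bounded (e ` I)"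
    and lim: "\<And>a. ((\<lambda>i. e i * a) \<longlongrightarrow> a) ?F"
    using bai by (auto simp: bounded_approximate_identity_def)
  have nb: "?F \<noteq> bot" by (rule net_filter_neq_bot[OF dir])
  have evI: "eventually (\<lambda>i. i \<in> I) ?F"
    using dir by (auto simp: eventually_net_filter directed_set_def)
  have TL: "a * T b = T a * b" for a b
    using T by (simp add: two_sided_centralizers_def) metis
  have faithful: "x = y" if "\<And>a. a * x = a * y" for x y :: 'a
    using tendsto_unique[OF nb lim[of x]] lim[of y] that by simp
  have add: "T (x + y) = T x + T y" for x y
    by (rule faithful) (simp add: TL distrib_left distrib_right)
  have scC: "T (c *\<^sub>C x) = c *\<^sub>C T x" for c x
    by (rule faithful) (simp add: TL mult_scaleC_right)
  obtain B where B: "\<And>i. i \<in> I \<Longrightarrow> norm (e i) \<le> B"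
    using bdd unfolding bounded_iff by auto
  define C where "C n = {x. \<forall>i\<in>I. norm (T (e i) * x) \<le> real n}" for n
  have closedC: "closed (C n)" for n
  proof -
    have "C n = (\<Inter>i\<in>I. {x. norm (T (e i) * x) \<le> real n})" by (auto simp: C_def)
    also have "closed \<dots>"
      by (intro closed_INT ballI closed_Collect_le continuous_intros)
    finally show ?thesis .
  qed
  have "\<exists>n. x \<in> C n" for x
  proof -
    obtain n where n: "B * norm (T x) \<le> real n" using real_arch_simple by blast
    have "norm (T (e i) * x) \<le> real n" if "i \<in> I" for i
    proof -
      have "norm (T (e i) * x) = norm (e i * T x)" by (simp add: TL)
      also have "\<dots> \<le> norm (e i) * norm (T x)" by (rule norm_mult_ineq)
      also have "\<dots> \<le> B * norm (T x)" by (rule mult_right_mono[OF B[OF that]]) simp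
      finally show ?thesis using n by linarith
    qed
    then show ?thesis by (auto simp: C_def)
  qed
  then have empty: "\<Inter>(range (\<lambda>n. - C n)) = {}" by auto
  have "\<exists>n. closure (- C n) \<noteq> UNIV"
  proof (rule ccontr)
    assume "\<not> ?thesis"
    then have dense: "\<And>n. closure (- C n) = UNIV" by blast
    have "euclidean closure_of \<Inter>(range (\<lambda>n. - C n)) = topspace euclidean"
      using closedC dense
      by (intro Baire_category) (auto simp: open_Compl completely_metrizable_space_euclidean)
    then show False by (simp add: empty)
  qed
  then obtain n where "interior (C n) \<noteq> {}" by (auto simp: closure_complement)
  then obtain x0 where "x0 \<in> interior (C n)" by blast
  then obtain r where r: "r > 0" "cball x0 r \<subseteq> C n"
    by (auto simp: mem_interior_cball)
  have small: "norm (T (e i) * y) \<le> 2 * real n" if "norm y \<le> r" "i \<in> I" for y i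
  proof -
    have "x0 + y \<in> C n" "x0 \<in> C n"
      using r that by (auto simp: subset_iff dist_norm)
    then have "norm (T (e i) * (x0 + y)) \<le> real n" "norm (T (e i) * x0) \<le> real n"
      using that(2) by (auto simp: C_def)
    moreover have "T (e i) * y = T (e i) * (x0 + y) - T (e i) * x0"
      by (simp add: distrib_left)
    ultimately show ?thesis
      using norm_triangle_ineq4[of "T (e i) * (x0 + y)" "T (e i) * x0"] by simp
  qed
  have bound: "norm (T x) \<le> norm x * (2 * real n / r)" for x
  proof (rule tendsto_upperbound[OF tendsto_norm[OF lim[of "T x"]] _ nb])
    have "norm (e i * T x) \<le> norm x * (2 * real n / r)" if i: "i \<in> I" for i
    proof (cases "x = 0")
      case True
      then show ?thesis by (simp add: TL)
    next
      case False
      have "norm (T (e i) * ((r / norm x) *\<^sub>R x)) \<le> 2 * real n"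
        by (rule small) (use i False r in auto)
      then have "(r / norm x) * norm (T (e i) * x) \<le> 2 * real n" using r by simp
      then show ?thesis using False r by (simp add: TL field_simps)
    qed
    with evI show "eventually (\<lambda>i. norm (e i * T x) \<le> norm x * (2 * real n / r)) ?F"
      by (auto elim: eventually_mono)
  qed
  have "bounded_linear T"
    by (rule bounded_linear_intro[OF add _ bound])
      (use scC scaleC_of_real in metis)
  with scC show ?thesis by (simp add: bounded_clinear_def)
qed

end

theory Submission
  imports Defs
begin

text \<open>If \<open>T\<close> is a bounded \<open>(p, q)\<close>-centralizer, inserting the approximate identity \<open>e\<close> in the
  defining identity on the right and on the left and cancelling shows \<open>a * T (e i) \<longlongrightarrow> T a\<close> and
  \<open>T (e i) * a \<longlongrightarrow> T a\<close>. Associativity then gives \<open>T (a * b) = T a * b = a * T b\<close> in the limit.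
  Conversely every two-sided centralizer is a bounded \<open>(p, q)\<close>-centralizer, so the two spaces
  coincide and closedness is immediate.\<close>

lemma bounded_pq_centralizer_tendsto:
  fixes T :: "'a::complex_banach_algebra \<Rightarrow> 'a"
  assumes "p > 0" "q > 0" and bai: "bounded_approximate_identity I le e"
    and T: "T \<in> bounded_pq_centralizers p q"
  shows "((\<lambda>i. a * T (e i)) \<longlongrightarrow> T a) (net_filter I le)"
    and "((\<lambda>i. T (e i) * a) \<longlongrightarrow> T a) (net_filter I le)"
proof -
  let ?F = "net_filter I le"
  have lim: "((\<lambda>i. e i * x) \<longlongrightarrow> x) ?F" "((\<lambda>i. x * e i) \<longlongrightarrow> x) ?F" for x
    using bai by (auto simp: bounded_approximate_identity_def)
  have bl: "bounded_linear T"
    using T by (simp add: bounded_pq_centralizers_def bounded_clinear_def)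
  have pq: "real (p + q) *\<^sub>R T (x * y) = real p *\<^sub>R (T x * y) + real q *\<^sub>R (x * T y)" for x y
    using T by (simp add: bounded_pq_centralizers_def)
  \<comment> \<open>With a unit, putting b = 1 in the identity would give
    \<open>T a = a * T 1\<close>. Here \<open>e i\<close> stands in for the unit: the identity at
    \<open>a\<close> and \<open>e i\<close> is solved for the term to be controlled, dividing by
    q.\<close>
  have "a * T (e i)
      = (1 / real q) *\<^sub>R (real (p + q) *\<^sub>R T (a * e i) - real p *\<^sub>R (T a * e i))" for i
    using \<open>q > 0\<close> pq[of a "e i"] by (simp del: of_nat_add)
  \<comment> \<open>Continuity of \<open>T\<close> enters here, turning
    \<open>a * e i \<longlongrightarrow> a\<close> into
    \<open>T (a * e i) \<longlongrightarrow> T a\<close>.\<close>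
  moreover have "((\<lambda>i. (1 / real q) *\<^sub>R (real (p + q) *\<^sub>R T (a * e i) - real p *\<^sub>R (T a * e i)))
      \<longlongrightarrow> (1 / real q) *\<^sub>R (real (p + q) *\<^sub>R T a - real p *\<^sub>R T a)) ?F"
    by (intro tendsto_intros bounded_linear.tendsto[OF bl] lim)
  moreover have "(1 / real q) *\<^sub>R (real (p + q) *\<^sub>R T a - real p *\<^sub>R T a) = T a"
    using \<open>q > 0\<close> by (simp add: scaleR_left_diff_distrib[symmetric])
  ultimately show "((\<lambda>i. a * T (e i)) \<longlongrightarrow> T a) ?F" by (simp del: of_nat_add)
  \<comment> \<open>The mirror image: \<open>e i\<close> is now the left factor, and the division is
    by p.\<close>
  have "T (e i) * a
      = (1 / real p) *\<^sub>R (real (p + q) *\<^sub>R T (e i * a) - real q *\<^sub>R (e i * T a))" for i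
    using \<open>p > 0\<close> pq[of "e i" a] by (simp del: of_nat_add)
  moreover have "((\<lambda>i. (1 / real p) *\<^sub>R (real (p + q) *\<^sub>R T (e i * a) - real q *\<^sub>R (e i * T a)))
      \<longlongrightarrow> (1 / real p) *\<^sub>R (real (p + q) *\<^sub>R T a - real q *\<^sub>R T a)) ?F"
    by (intro tendsto_intros bounded_linear.tendsto[OF bl] lim)
  moreover have "(1 / real p) *\<^sub>R (real (p + q) *\<^sub>R T a - real q *\<^sub>R T a) = T a"
    using \<open>p > 0\<close> by (simp add: scaleR_left_diff_distrib[symmetric])
  ultimately show "((\<lambda>i. T (e i) * a) \<longlongrightarrow> T a) ?F" by (simp del: of_nat_add)
qed

lemma bounded_pq_centralizers_eq_two_sided_centralizers:
  fixes e :: "'i \<Rightarrow> 'a::complex_banach_algebra"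
  assumes "p > 0" "q > 0" and bai: "bounded_approximate_identity I le e"
  shows "bounded_pq_centralizers p q = (two_sided_centralizers :: ('a \<Rightarrow> 'a) set)"
proof (intro equalityI subsetI)
  fix T :: "'a \<Rightarrow> 'a"
  assume T: "T \<in> bounded_pq_centralizers p q"
  note lim = bounded_pq_centralizer_tendsto[OF assms T]
  have nb: "net_filter I le \<noteq> bot"
    using bai by (simp add: net_filter_neq_bot bounded_approximate_identity_def)
  \<comment> \<open>The net \<open>T (e i) * (a * b) = (T (e i) * a) * b\<close> tends to both
    sides, and limits along a nontrivial filter are unique.\<close>
  have "T (a * b) = T a * b" for a b
    by (rule tendsto_unique[OF nb lim(2)[of "a * b"]])
      (use tendsto_mult_right[OF lim(2)[of a], of b] in \<open>simp add: mult.assoc\<close>)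
  moreover have "T (a * b) = a * T b" for a b
    by (rule tendsto_unique[OF nb lim(1)[of "a * b"]])
      (use tendsto_mult_left[OF lim(1)[of b], of a] in \<open>simp add: mult.assoc\<close>)
  ultimately show "T \<in> two_sided_centralizers" by (simp add: two_sided_centralizers_def)
next
  fix T :: "'a \<Rightarrow> 'a"
  assume T: "T \<in> two_sided_centralizers"
  then have L: "T (a * b) = T a * b" and "T (a * b) = a * T b" for a b
    unfolding two_sided_centralizers_def by blast+
  then have "a * T b = T a * b" for a b by metis
  \<comment> \<open>Both products in the defining identity equal \<open>T (a * b)\<close>, so the
    weights p and q simply add up.\<close>
  with L show "T \<in> bounded_pq_centralizers p q"
    using two_sided_centralizer_bounded_clinear[OF bai T]
    by (simp add: bounded_pq_centralizers_def scaleR_add_left)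
qed

theorem theorem2p4:
  fixes p q :: nat
    and I :: "'i set" and le :: "'i \<Rightarrow> 'i \<Rightarrow> bool"
    and e :: "'i \<Rightarrow> 'a::complex_banach_algebra"
  assumes "p > 0" and "q > 0" and "p \<noteq> q"
    and "bounded_approximate_identity I le e"
  shows "(bounded_pq_centralizers p q :: ('a \<Rightarrow> 'a) set) \<subseteq> two_sided_centralizers
    \<and> module.subspace fun_scaleC (bounded_pq_centralizers p q :: ('a \<Rightarrow> 'a) set)
    \<and> closedin (operator_norm_topology (two_sided_centralizers :: ('a \<Rightarrow> 'a) set))
        (bounded_pq_centralizers p q)"
proof -
  have eq: "bounded_pq_centralizers p q = (two_sided_centralizers :: ('a \<Rightarrow> 'a) set)"
    by (rule bounded_pq_centralizers_eq_two_sided_centralizers[OF assms(1,2,4)])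
  \<comment> \<open>Pulling back the topology of a full space along \<open>Blinfun\<close> leaves
    all of \<open>M\<close> as carrier, and a carrier is closed in itself.\<close>
  have "topspace (operator_norm_topology M) = M" for M :: "('a \<Rightarrow> 'a) set"
    by (simp add: operator_norm_topology_def topspace_pullback_topology)
  then have "closedin (operator_norm_topology M) M" for M :: "('a \<Rightarrow> 'a) set"
    by (metis closedin_topspace)
  with eq show ?thesis by (simp add: subspace_two_sided_centralizers)
qed

end
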